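(* Let $\hat{\mathfrak T}$ be a finite partially ordered set with a top element $\mathcal T$, and let $\mathcal F$ be a function space on $\hat{\mathfrak T}$. Assume that we have a consistent family of extension operators $E^F_K\colon\mathring{\mathcal F}(K)\to\mathcal F(F)$, $K,F\in\hat{\mathfrak T}$. Then $\mathcal F(\mathcal T)$ is the (internal) direct sum $$\mathcal F(\mathcal T)=\bigoplus_{F\in\hat{\mathfrak T}}E_F^{\mathcal T}\mathring{\mathcal F}(F).$$
   Context: All vector spaces are over a fixed field. A function space $\mathcal F$ on a partially ordered set $P$ consists of a vector space $\mathcal F(F)$ for every $F\in P$ and a linear map $\operatorname{tr}^F_K\colon\mathcal F(F)\to\mathcal F(K)$ (trace map) for every relation $K\le F$, such that $\operatorname{tr}^F_F$ is the identity and $\operatorname{tr}^G_K\circ\operatorname{tr}^F_G=\operatorname{tr}^F_K$ whenever $K\le G\le F$. The subspace of vanishing trace is $\mathring{\mathcal F}(F)=\{\phi\in\mathcal F(F)\mid\operatorname{tr}^F_K\phi=0\text{ for all }K<F\}$. A consistent family of extension operators on $P$ is a family of linear maps $E^F_K\colon\mathring{\mathcal F}(K)\to\mathcal F(F)$, one for every $K,F\in P$, such that (i) $E^K_K$ is the inclusion $\mathring{\mathcal F}(K)\to\mathcal F(K)$; (ii) $E^F_K=0$ if $K\not\le F$; (iii) $\operatorname{tr}^F_GE^F_K=E^G_K$ whenever $G\le F$. Here $\mathcal F(\mathcal T)$ is just the vector space that the function space assigns to the top element $\mathcal T$ (no further assumption on it, and $\mathring{\mathcal F}(\mathcal T)$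 need not be zero). *)

theory Defs
  imports "Jordan_Normal_Form.Missing_VectorSpace"
begin

text \<open>
  The order is a relation on a carrier set: \<open>(K, F) \<in> r\<close> means \<open>K \<le> F\<close>.
  Each \<open>V F\<close> is a vector space of its own, with its own carrier, zero and operations; that all the
  carriers live in one type \<open>'v\<close> is no restriction, as nothing relates the structures of different
  \<open>V F\<close>. Indices are in the order upper, lower: \<open>tr F K\<close> maps \<open>V F\<close> to \<open>V K\<close>, and
  \<open>E F K\<close> maps into \<open>V F\<close>.
\<close>

locale function_space =
  fixes k :: "('a, 'm) ring_scheme"
    and P :: "'p set"
    and r :: "'p rel"
    and V :: "'p \<Rightarrow> ('a, 'v, 'n) module_scheme"
    and tr :: "'p \<Rightarrow> 'p \<Rightarrow> 'v \<Rightarrow> 'v"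
  assumes field: "field k"
    and partial_order: "partial_order_on P r"
    and vectorspace: "F \<in> P \<Longrightarrow> vectorspace k (V F)"
    and tr_linear: "(K, F) \<in> r \<Longrightarrow> tr F K \<in> module_hom k (V F) (V K)"
    and tr_refl: "F \<in> P \<Longrightarrow> \<phi> \<in> carrier (V F) \<Longrightarrow> tr F F \<phi> = \<phi>"
    and tr_trans: "(K, G) \<in> r \<Longrightarrow> (G, F) \<in> r \<Longrightarrow> \<phi> \<in> carrier (V F) \<Longrightarrow>
      tr G K (tr F G \<phi>) = tr F K \<phi>"

definition vanishing_trace ::
  "'p rel \<Rightarrow> ('p \<Rightarrow> ('a, 'v, 'n) module_scheme) \<Rightarrow> ('p \<Rightarrow> 'p \<Rightarrow> 'v \<Rightarrow> 'v) \<Rightarrow> 'p \<Rightarrow> 'v set"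
  where "vanishing_trace r V tr F =
    {\<phi> \<in> carrier (V F). \<forall>K. (K, F) \<in> r \<and> K \<noteq> F \<longrightarrow> tr F K \<phi> = \<zero>\<^bsub>V K\<^esub>}"

locale consistent_extension = function_space k P r V tr
  for k :: "('a, 'm) ring_scheme"
    and P :: "'p set"
    and r :: "'p rel"
    and V :: "'p \<Rightarrow> ('a, 'v, 'n) module_scheme"
    and tr :: "'p \<Rightarrow> 'p \<Rightarrow> 'v \<Rightarrow> 'v" +
  fixes E :: "'p \<Rightarrow> 'p \<Rightarrow> 'v \<Rightarrow> 'v"
  assumes E_linear: "K \<in> P \<Longrightarrow> F \<in> P \<Longrightarrow>
      E F K \<in> module_hom k ((V K)\<lparr>carrier := vanishing_trace r V tr K\<rparr>) (V F)"
    and E_refl: "K \<in> P \<Longrightarrow> \<phi> \<in> vanishing_trace r V tr K \<Longrightarrow> E K K \<phi> = \<phi>"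
    and E_zero: "K \<in> P \<Longrightarrow> F \<in> P \<Longrightarrow> (K, F) \<notin> r \<Longrightarrow>
      \<phi> \<in> vanishing_trace r V tr K \<Longrightarrow> E F K \<phi> = \<zero>\<^bsub>V F\<^esub>"
    and tr_E: "K \<in> P \<Longrightarrow> (G, F) \<in> r \<Longrightarrow> \<phi> \<in> vanishing_trace r V tr K \<Longrightarrow>
      tr F G (E F K \<phi>) = E G K \<phi>"

text \<open>
  The families \<open>w\<close> are taken in the extensional function space, so that the uniqueness is only about
  the values on \<open>I\<close>. Finiteness of \<open>I\<close> is part of the definition since \<open>finsum\<close> is \<open>\<zero>\<close> by
  convention over an infinite set.
\<close>

definition internal_direct_sum ::
  "('a, 'm) ring_scheme \<Rightarrow> ('a, 'v, 'n) module_scheme \<Rightarrow> 'i set \<Rightarrow> ('i \<Rightarrow> 'v set) \<Rightarrow> bool"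
  where "internal_direct_sum k M I W \<longleftrightarrow>
    finite I \<and> (\<forall>i\<in>I. subspace k (W i) M) \<and>
    (\<forall>v\<in>carrier M. \<exists>!w. w \<in> (\<Pi>\<^sub>E i\<in>I. W i) \<and> v = (\<Oplus>\<^bsub>M\<^esub>i\<in>I. w i))"

end

theory Submission
  imports Defs
begin

text \<open>
  Any element \<open>\<phi>\<close> of \<open>V F\<close> is decomposed by peeling off its traces from the bottom of the poset
  upwards. Call \<open>{K \<le> F. tr F K \<phi> \<noteq> 0}\<close> the support of \<open>\<phi>\<close>. At a minimal element \<open>K\<close> of the
  support the trace of \<open>\<phi>\<close> has itself vanishing trace, hence can be extended back to \<open>V F\<close>, and
  subtracting the extension removes \<open>K\<close> from the support. Nothing is added to the support: by
  consistency the extension has nonzero trace only at elements \<open>G \<ge> K\<close>, and these were in the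
  support already, since a vanishing trace at \<open>G\<close> forces a vanishing trace at \<open>K\<close>. The support is
  finite, so the process stops, and it stops at \<open>0\<close>, because an element with empty support equals its
  trace at \<open>F\<close>, which is \<open>0\<close> (\<open>extension_decomposition_exists\<close>).

  Conversely the extension operators are triangular with respect to the order: the trace at \<open>G\<close> of
  \<open>\<Sum>K. E F K (\<psi> K)\<close> only involves \<open>\<psi> K\<close> for \<open>K \<le> G\<close>, and \<open>\<psi> G\<close> enters it unchanged. So the
  sum determines the \<open>\<psi> G\<close> by well-founded induction on \<open>G\<close> (\<open>extension_decomposition_unique\<close>).

  This decomposes \<open>V F\<close> into the extensions from all \<open>K \<le> F\<close>, for every \<open>F\<close>; the case where \<open>F\<close> is
  the top element yields the sum over the whole poset.
\<close>

section \<open>Subspaces of vanishing trace\<close>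

lemma (in mod_hom) hom_finsum:
  assumes "finite I" and "g \<in> I \<rightarrow> carrier M"
  shows "f (\<Oplus>\<^bsub>M\<^esub>i\<in>I. g i) = (\<Oplus>\<^bsub>N\<^esub>i\<in>I. f (g i))"
  using assms
proof (induction I)
  case empty
  then show ?case by simp
next
  case (insert i I)
  then have "g \<in> I \<rightarrow> carrier M" "g i \<in> carrier M" by auto
  moreover from this have "(\<lambda>i. f (g i)) \<in> I \<rightarrow> carrier N" "f (g i) \<in> carrier N" by auto
  ultimately show ?case
    using insert by simp
qed

context function_space
begin

abbreviation vt :: "'p \<Rightarrow> 'v set" where
  "vt \<equiv> vanishing_trace r V tr"

lemma in_P: "(K, F) \<in> r \<Longrightarrow> K \<in> P \<and> F \<in> P"
  using partial_order_onD(4)[OF partial_order] by blast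

lemma r_refl: "F \<in> P \<Longrightarrow> (F, F) \<in> r"
  using partial_order_onD(1)[OF partial_order] by (simp add: refl_on_def)

lemma r_trans: "(K, G) \<in> r \<Longrightarrow> (G, F) \<in> r \<Longrightarrow> (K, F) \<in> r"
  using partial_order_onD(2)[OF partial_order] by (meson transD)

lemma wf_strict: "finite P \<Longrightarrow> wf (r - Id)"
  using partial_order_onD(4)[OF partial_order] partial_order
  by (meson finite_SigmaI finite_subset partial_order_on_well_order_on)

lemma module_V: "F \<in> P \<Longrightarrow> module k (V F)"
  using vectorspace by (simp add: vectorspace_def)

lemma tr_mod_hom: "(K, F) \<in> r \<Longrightarrow> mod_hom k (V F) (V K) (tr F K)"
  by (simp add: in_P module_V mod_hom_axioms.intro mod_hom.intro tr_linear)

lemma vt_carrier: "\<phi> \<in> vt F \<Longrightarrow> \<phi> \<in> carrier (V F)"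
  by (simp add: vanishing_trace_def)

lemma submodule_vt:
  assumes F: "F \<in> P"
  shows "submodule k (vt F) (V F)"
proof -
  interpret F: module k "V F" using F by (rule module_V)
  show ?thesis
  proof
    show "vt F \<subseteq> carrier (V F)" by (auto simp: vanishing_trace_def)
  next
    fix v w assume vw: "v \<in> vt F" "w \<in> vt F"
    have "tr F K (v \<oplus>\<^bsub>V F\<^esub> w) = \<zero>\<^bsub>V K\<^esub>" if "(K, F) \<in> r" "K \<noteq> F" for K
    proof -
      interpret t: mod_hom k "V F" "V K" "tr F K" using that(1) by (rule tr_mod_hom)
      show ?thesis using vw that by (simp add: vanishing_trace_def)
    qed
    then show "v \<oplus>\<^bsub>V F\<^esub> w \<in> vt F" using vw by (simp add: vanishing_trace_def)
  next
    have "tr F K \<zero>\<^bsub>V F\<^esub> = \<zero>\<^bsub>V K\<^esub>" if "(K, F) \<in> r" for K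
    proof -
      interpret t: mod_hom k "V F" "V K" "tr F K" using that by (rule tr_mod_hom)
      show ?thesis by simp
    qed
    then show "\<zero>\<^bsub>V F\<^esub> \<in> vt F" by (simp add: vanishing_trace_def)
  next
    fix c v assume c: "c \<in> carrier k" and v: "v \<in> vt F"
    have "tr F K (c \<odot>\<^bsub>V F\<^esub> v) = \<zero>\<^bsub>V K\<^esub>" if "(K, F) \<in> r" "K \<noteq> F" for K
    proof -
      interpret t: mod_hom k "V F" "V K" "tr F K" using that(1) by (rule tr_mod_hom)
      show ?thesis using c v that by (simp add: vanishing_trace_def)
    qed
    then show "c \<odot>\<^bsub>V F\<^esub> v \<in> vt F" using c v by (simp add: vanishing_trace_def)
  qed
qed

end

section \<open>Extensions from subspaces of vanishing trace\<close>

context consistent_extension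
begin

lemma E_mod_hom:
  assumes "K \<in> P" and "F \<in> P"
  shows "mod_hom k ((V K)\<lparr>carrier := vt K\<rparr>) (V F) (E F K)"
  using assms E_linear module_V submodule_vt
  by (simp add: module.submodule_is_module mod_hom_axioms.intro mod_hom.intro)

lemma E_carrier: "K \<in> P \<Longrightarrow> F \<in> P \<Longrightarrow> \<phi> \<in> vt K \<Longrightarrow> E F K \<phi> \<in> carrier (V F)"
  using mod_hom.f_im[OF E_mod_hom] by simp

lemma E_add:
  "K \<in> P \<Longrightarrow> F \<in> P \<Longrightarrow> \<phi> \<in> vt K \<Longrightarrow> \<psi> \<in> vt K \<Longrightarrow>
    E F K (\<phi> \<oplus>\<^bsub>V K\<^esub> \<psi>) = E F K \<phi> \<oplus>\<^bsub>V F\<^esub> E F K \<psi>"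
  using module_hom_add[OF E_linear] by simp

lemma E_0: "K \<in> P \<Longrightarrow> F \<in> P \<Longrightarrow> E F K \<zero>\<^bsub>V K\<^esub> = \<zero>\<^bsub>V F\<^esub>"
  using mod_hom.f0_is_0[OF E_mod_hom] by simp

lemma subspace_E_image:
  assumes "K \<in> P" and "F \<in> P"
  shows "subspace k (E F K ` vt K) (V F)"
  using mod_hom.im_is_submodule[OF E_mod_hom] mod_hom.im_def[OF E_mod_hom] assms vectorspace
  by (simp add: subspace.intro)

section \<open>Decomposition into extensions\<close>

text \<open>
  The induction is on the size of the support: the extension of the trace at a minimal element of the
  support is split off, and the support of the remainder is strictly smaller.
\<close>

theorem extension_decomposition_exists:
  assumes fin: "finite P" and F: "F \<in> P" and \<phi>: "\<phi> \<in> carrier (V F)"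
  shows "\<exists>\<psi>. (\<forall>K. (K, F) \<in> r \<longrightarrow> \<psi> K \<in> vt K) \<and> \<phi> = (\<Oplus>\<^bsub>V F\<^esub>K\<in>{K. (K, F) \<in> r}. E F K (\<psi> K))"
proof -
  define D where "D = {K. (K, F) \<in> r}"
  define supp where "supp \<phi> = {K \<in> D. tr F K \<phi> \<noteq> \<zero>\<^bsub>V K\<^esub>}" for \<phi>
  have DP: "D \<subseteq> P" using in_P by (auto simp: D_def)
  have finD: "finite D" using DP fin by (rule finite_subset)
  interpret F: module k "V F" using F by (rule module_V)
  have "\<exists>\<psi>. (\<forall>K\<in>D. \<psi> K \<in> vt K) \<and> \<phi> = (\<Oplus>\<^bsub>V F\<^esub>K\<in>D. E F K (\<psi> K))"
    using \<phi>
  proof (induction "card (supp \<phi>)" arbitrary: \<phi> rule: less_induct)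
    case less
    show ?case
    proof (cases "supp \<phi> = {}")
      case True
      then have "tr F F \<phi> = \<zero>\<^bsub>V F\<^esub>" using r_refl[OF F] by (auto simp: supp_def D_def)
      then have "\<phi> = \<zero>\<^bsub>V F\<^esub>" using tr_refl F less.prems by simp
      moreover have "(\<Oplus>\<^bsub>V F\<^esub>K\<in>D. E F K \<zero>\<^bsub>V K\<^esub>) = (\<Oplus>\<^bsub>V F\<^esub>K\<in>D. \<zero>\<^bsub>V F\<^esub>)"
        using DP F E_0 by (intro F.M.finsum_cong') auto
      moreover have "\<zero>\<^bsub>V K\<^esub> \<in> vt K" if "K \<in> D" for K
        using submodule.zero_closed[OF submodule_vt] that DP by blast
      ultimately show ?thesis
        by (intro exI[of _ "\<lambda>K. \<zero>\<^bsub>V K\<^esub>"]) (simp add: F.M.finsum_zero)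
    next
      case False
      then obtain K where K: "K \<in> supp \<phi>" and Kmin: "\<And>G. (G, K) \<in> r - Id \<Longrightarrow> G \<notin> supp \<phi>"
        using wfE_min[OF wf_strict[OF fin]] by (metis all_not_in_conv)
      have KD: "K \<in> D" and KF: "(K, F) \<in> r" and KP: "K \<in> P"
        using K DP by (auto simp: supp_def D_def)
      define \<alpha> where "\<alpha> = tr F K \<phi>"
      interpret trK: mod_hom k "V F" "V K" "tr F K" using KF by (rule tr_mod_hom)
      \<comment> \<open>Minimality of \<open>K\<close> is what makes \<open>\<alpha>\<close> extendable.\<close>
      have "tr K G \<alpha> = \<zero>\<^bsub>V G\<^esub>" if "(G, K) \<in> r" "G \<noteq> K" for G
        using Kmin[of G] that r_trans[OF that(1) KF] tr_trans[OF that(1) KF less.prems]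
        by (auto simp: supp_def D_def \<alpha>_def)
      then have \<alpha>: "\<alpha> \<in> vt K"
        using less.prems by (simp add: vanishing_trace_def \<alpha>_def)
      have E\<alpha>: "E F K \<alpha> \<in> carrier (V F)" using KP F \<alpha> by (rule E_carrier)
      define \<phi>' where "\<phi>' = \<phi> \<ominus>\<^bsub>V F\<^esub> E F K \<alpha>"
      have \<phi>': "\<phi>' \<in> carrier (V F)" using less.prems E\<alpha> by (simp add: \<phi>'_def)
      have tr_\<phi>': "tr F G \<phi>' = tr F G \<phi> \<ominus>\<^bsub>V G\<^esub> E G K \<alpha>" if "G \<in> D" for G
      proof -
        interpret trG: mod_hom k "V F" "V G" "tr F G"
          using that by (intro tr_mod_hom) (simp add: D_def)
        show ?thesis
          using that less.prems E\<alpha> tr_E[OF KP _ \<alpha>] by (simp add: \<phi>'_def D_def)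
      qed
      have "tr F K \<phi>' = \<zero>\<^bsub>V K\<^esub>"
        using tr_\<phi>'[OF KD] E_refl[OF KP \<alpha>] vt_carrier[OF \<alpha>]
        by (simp add: \<alpha>_def[symmetric] trK.N.M.minus_eq trK.N.M.r_neg)
      then have K': "K \<notin> supp \<phi>'" by (simp add: supp_def)
      \<comment> \<open>If \<open>G\<close> is outside the support of \<open>\<phi>\<close>, then \<open>K \<le> G\<close> fails, so the extension has zero trace at \<open>G\<close>.\<close>
      have "supp \<phi>' \<subseteq> supp \<phi>"
      proof
        fix G assume G: "G \<in> supp \<phi>'"
        then have GD: "G \<in> D" and GF: "(G, F) \<in> r" and GP: "G \<in> P"
          using DP by (auto simp: supp_def D_def)
        interpret G: module k "V G" using GP by (rule module_V)
        show "G \<in> supp \<phi>"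
        proof (rule ccontr)
          assume "G \<notin> supp \<phi>"
          then have 0: "tr F G \<phi> = \<zero>\<^bsub>V G\<^esub>" using GD by (simp add: supp_def)
          have "(K, G) \<notin> r"
          proof
            assume KG: "(K, G) \<in> r"
            interpret trGK: mod_hom k "V G" "V K" "tr G K" using KG by (rule tr_mod_hom)
            have "tr F K \<phi> = \<zero>\<^bsub>V K\<^esub>" using tr_trans[OF KG GF less.prems] 0 by simp
            then show False using K by (simp add: supp_def)
          qed
          then have "tr F G \<phi>' = \<zero>\<^bsub>V G\<^esub>"
            using tr_\<phi>'[OF GD] E_zero[OF KP GP _ \<alpha>] 0 by (simp add: G.M.minus_eq G.M.r_neg)
          then show False using G by (simp add: supp_def)
        qed
      qed
      then have "supp \<phi>' \<subset> supp \<phi>" using K K' by blast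
      moreover have "finite (supp \<phi>)" using finD by (simp add: supp_def)
      ultimately have "card (supp \<phi>') < card (supp \<phi>)" by (rule psubset_card_mono[rotated])
      from less.hyps[OF this \<phi>'] obtain \<psi> where
        \<psi>: "\<And>G. G \<in> D \<Longrightarrow> \<psi> G \<in> vt G" and sum: "\<phi>' = (\<Oplus>\<^bsub>V F\<^esub>G\<in>D. E F G (\<psi> G))"
        by blast
      define \<psi>' where "\<psi>' = \<psi>(K := \<alpha> \<oplus>\<^bsub>V K\<^esub> \<psi> K)"
      have \<psi>': "\<psi>' G \<in> vt G" if "G \<in> D" for G
        using \<psi>[OF that] \<alpha> submodule.m_closed[OF submodule_vt[OF KP]]
        by (auto simp: \<psi>'_def)
      have E\<psi>: "E F G (\<psi> G) \<in> carrier (V F)" if "G \<in> D" for G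
        using that DP F \<psi> E_carrier by blast
      have ins: "D = insert K (D - {K})" using KD by blast
      have rest: "(\<Oplus>\<^bsub>V F\<^esub>G\<in>D - {K}. E F G (\<psi> G)) \<in> carrier (V F)"
        using E\<psi> by (intro F.M.finsum_closed) auto
      have "(\<Oplus>\<^bsub>V F\<^esub>G\<in>D. E F G (\<psi>' G)) = E F K (\<psi>' K) \<oplus>\<^bsub>V F\<^esub> (\<Oplus>\<^bsub>V F\<^esub>G\<in>D - {K}. E F G (\<psi>' G))"
        using finD KD DP F \<psi>' E_carrier by (subst ins, subst F.M.finsum_insert) auto
      also have "(\<Oplus>\<^bsub>V F\<^esub>G\<in>D - {K}. E F G (\<psi>' G)) = (\<Oplus>\<^bsub>V F\<^esub>G\<in>D - {K}. E F G (\<psi> G))"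
        using E\<psi> by (intro F.M.finsum_cong') (auto simp: \<psi>'_def)
      also have "E F K (\<psi>' K) = E F K \<alpha> \<oplus>\<^bsub>V F\<^esub> E F K (\<psi> K)"
        using E_add[OF KP F \<alpha> \<psi>[OF KD]] by (simp add: \<psi>'_def)
      also have "\<dots> \<oplus>\<^bsub>V F\<^esub> (\<Oplus>\<^bsub>V F\<^esub>G\<in>D - {K}. E F G (\<psi> G)) =
          E F K \<alpha> \<oplus>\<^bsub>V F\<^esub> (E F K (\<psi> K) \<oplus>\<^bsub>V F\<^esub> (\<Oplus>\<^bsub>V F\<^esub>G\<in>D - {K}. E F G (\<psi> G)))"
        using E\<alpha> E\<psi>[OF KD] rest by (rule F.M.a_assoc)
      also have "E F K (\<psi> K) \<oplus>\<^bsub>V F\<^esub> (\<Oplus>\<^bsub>V F\<^esub>G\<in>D - {K}. E F G (\<psi> G)) = (\<Oplus>\<^bsub>V F\<^esub>G\<in>D. E F G (\<psi> G))"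
        using finD KD E\<psi> by (subst (2) ins, subst F.M.finsum_insert) auto
      also have "\<dots> = \<phi>'" using sum by simp
      also have "E F K \<alpha> \<oplus>\<^bsub>V F\<^esub> \<phi>' = \<phi>"
        using E\<alpha> less.prems
        by (simp add: \<phi>'_def F.M.minus_eq F.M.a_lcomm F.M.r_neg)
      finally show ?thesis using \<psi>' by (intro exI[of _ \<psi>']) auto
    qed
  qed
  then show ?thesis by (simp add: D_def)
qed

text \<open>
  Taking the trace at \<open>G\<close> turns the equation of the two sums into one between sums of \<open>E G K (\<psi> K)\<close>
  and \<open>E G K (\<chi> K)\<close>, whose terms at \<open>K = G\<close> are \<open>\<psi> G\<close> and \<open>\<chi> G\<close>. Once \<open>\<psi>\<close> and \<open>\<chi>\<close> are known to
  agree strictly below \<open>G\<close>, all the other terms cancel.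
\<close>

theorem extension_decomposition_unique:
  assumes fin: "finite P" and F: "F \<in> P"
    and \<psi>: "\<And>K. (K, F) \<in> r \<Longrightarrow> \<psi> K \<in> vt K" and \<chi>: "\<And>K. (K, F) \<in> r \<Longrightarrow> \<chi> K \<in> vt K"
    and eq: "(\<Oplus>\<^bsub>V F\<^esub>K\<in>{K. (K, F) \<in> r}. E F K (\<psi> K)) = (\<Oplus>\<^bsub>V F\<^esub>K\<in>{K. (K, F) \<in> r}. E F K (\<chi> K))"
    and "(G, F) \<in> r"
  shows "\<psi> G = \<chi> G"
  using \<open>(G, F) \<in> r\<close>
proof (induction G rule: wf_induct_rule[OF wf_strict[OF fin]])
  case (1 G)
  define D where "D = {K. (K, F) \<in> r}"
  have DP: "D \<subseteq> P" using in_P by (auto simp: D_def)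
  have finD: "finite D" using DP fin by (rule finite_subset)
  have GD: "G \<in> D" and GP: "G \<in> P" using 1(2) in_P by (auto simp: D_def)
  have ins: "D = insert G (D - {G})" using GD by blast
  interpret tr: mod_hom k "V F" "V G" "tr F G" using 1(2) by (rule tr_mod_hom)
  have cl: "E G K (\<omega> K) \<in> carrier (V G)" if "K \<in> D" "\<And>K. (K, F) \<in> r \<Longrightarrow> \<omega> K \<in> vt K" for K \<omega>
    using that DP GP E_carrier by (auto simp: D_def)
  have trace: "tr F G (\<Oplus>\<^bsub>V F\<^esub>K\<in>D. E F K (\<omega> K)) = \<omega> G \<oplus>\<^bsub>V G\<^esub> (\<Oplus>\<^bsub>V G\<^esub>K\<in>D - {G}. E G K (\<omega> K))"
    if \<omega>: "\<And>K. (K, F) \<in> r \<Longrightarrow> \<omega> K \<in> vt K" for \<omega>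
  proof -
    have "tr F G (\<Oplus>\<^bsub>V F\<^esub>K\<in>D. E F K (\<omega> K)) = (\<Oplus>\<^bsub>V G\<^esub>K\<in>D. tr F G (E F K (\<omega> K)))"
      using finD DP F \<omega> E_carrier by (intro tr.hom_finsum) (auto simp: D_def)
    also have "\<dots> = (\<Oplus>\<^bsub>V G\<^esub>K\<in>D. E G K (\<omega> K))"
      using tr_E[OF _ 1(2)] DP \<omega> cl by (intro tr.N.M.finsum_cong') (auto simp: D_def)
    also have "\<dots> = E G G (\<omega> G) \<oplus>\<^bsub>V G\<^esub> (\<Oplus>\<^bsub>V G\<^esub>K\<in>D - {G}. E G K (\<omega> K))"
      using finD cl \<omega> GD by (subst ins, subst tr.N.M.finsum_insert) auto
    finally show ?thesis using E_refl[OF GP \<omega>[OF 1(2)]] by simp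
  qed
  \<comment> \<open>Terms with \<open>K < G\<close> agree by induction; all others except the one at \<open>G\<close> are zero.\<close>
  have "E G K (\<psi> K) = E G K (\<chi> K)" if "K \<in> D - {G}" for K
  proof (cases "(K, G) \<in> r")
    case True
    then show ?thesis using 1(1)[of K] that by (auto simp: D_def)
  next
    case False
    then show ?thesis using that DP E_zero[OF _ GP False] \<psi> \<chi> by (auto simp: D_def)
  qed
  then have "(\<Oplus>\<^bsub>V G\<^esub>K\<in>D - {G}. E G K (\<psi> K)) = (\<Oplus>\<^bsub>V G\<^esub>K\<in>D - {G}. E G K (\<chi> K))"
    using cl \<chi> by (intro tr.N.M.finsum_cong') auto
  moreover have "tr F G (\<Oplus>\<^bsub>V F\<^esub>K\<in>D. E F K (\<psi> K)) = tr F G (\<Oplus>\<^bsub>V F\<^esub>K\<in>D. E F K (\<chi> K))"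
    using eq by (simp add: D_def)
  ultimately have "\<psi> G \<oplus>\<^bsub>V G\<^esub> (\<Oplus>\<^bsub>V G\<^esub>K\<in>D - {G}. E G K (\<chi> K)) =
      \<chi> G \<oplus>\<^bsub>V G\<^esub> (\<Oplus>\<^bsub>V G\<^esub>K\<in>D - {G}. E G K (\<chi> K))"
    using trace[of \<psi>] trace[of \<chi>] \<psi> \<chi> by simp
  moreover have "(\<Oplus>\<^bsub>V G\<^esub>K\<in>D - {G}. E G K (\<chi> K)) \<in> carrier (V G)"
    using cl \<chi> by (intro tr.N.M.finsum_closed) auto
  ultimately show ?case
    using \<psi>[OF 1(2)] \<chi>[OF 1(2)] vt_carrier tr.N.M.add.right_cancel by blast
qed

text \<open>
  The summands \<open>w K\<close> lie in the images of the extension operators, whereas existence and uniqueness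
  have been shown for preimages \<open>\<psi> K\<close>. Choosing preimages translates one into the other.
\<close>

theorem internal_direct_sum_extensions:
  assumes fin: "finite P" and F: "F \<in> P"
  shows "internal_direct_sum k (V F) {K. (K, F) \<in> r} (\<lambda>K. E F K ` vt K)"
  unfolding internal_direct_sum_def
proof (intro conjI ballI)
  show "finite {K. (K, F) \<in> r}"
    using in_P by (intro finite_subset[OF _ fin]) auto
next
  fix K assume "K \<in> {K. (K, F) \<in> r}"
  then show "subspace k (E F K ` vt K) (V F)"
    using in_P F by (intro subspace_E_image) auto
next
  fix \<phi> assume \<phi>: "\<phi> \<in> carrier (V F)"
  define D where "D = {K. (K, F) \<in> r}"
  interpret F: module k "V F" using F by (rule module_V)
  have lift: "\<exists>\<psi>. (\<forall>K. (K, F) \<in> r \<longrightarrow> \<psi> K \<in> vt K) \<and> w = (\<lambda>K\<in>D. E F K (\<psi> K)) \<and>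
      (\<Oplus>\<^bsub>V F\<^esub>K\<in>D. w K) = (\<Oplus>\<^bsub>V F\<^esub>K\<in>D. E F K (\<psi> K))"
    if w: "w \<in> (\<Pi>\<^sub>E K\<in>D. E F K ` vt K)" for w
  proof -
    have "\<forall>K\<in>D. \<exists>\<alpha>. \<alpha> \<in> vt K \<and> w K = E F K \<alpha>" using w by (auto simp: PiE_iff)
    then obtain \<psi> where \<psi>: "\<And>K. K \<in> D \<Longrightarrow> \<psi> K \<in> vt K \<and> w K = E F K (\<psi> K)" by metis
    have "w = (\<lambda>K\<in>D. E F K (\<psi> K))"
      using w \<psi> by (auto simp: PiE_iff extensional_def)
    moreover have "(\<Oplus>\<^bsub>V F\<^esub>K\<in>D. w K) = (\<Oplus>\<^bsub>V F\<^esub>K\<in>D. E F K (\<psi> K))"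
      using \<psi> E_carrier in_P F by (intro F.M.finsum_cong') (auto simp: D_def)
    ultimately show ?thesis using \<psi> by (auto simp: D_def)
  qed
  show "\<exists>!w. w \<in> (\<Pi>\<^sub>E K\<in>{K. (K, F) \<in> r}. E F K ` vt K) \<and> \<phi> = (\<Oplus>\<^bsub>V F\<^esub>K\<in>{K. (K, F) \<in> r}. w K)"
    unfolding D_def[symmetric]
  proof (rule ex_ex1I)
    obtain \<psi> where \<psi>: "\<And>K. (K, F) \<in> r \<Longrightarrow> \<psi> K \<in> vt K"
      and sum: "\<phi> = (\<Oplus>\<^bsub>V F\<^esub>K\<in>D. E F K (\<psi> K))"
      using extension_decomposition_exists[OF fin F \<phi>] by (auto simp: D_def)
    have "(\<Oplus>\<^bsub>V F\<^esub>K\<in>D. (\<lambda>K\<in>D. E F K (\<psi> K)) K) = \<phi>"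
      unfolding sum using \<psi> E_carrier in_P F
      by (intro F.M.finsum_cong') (auto simp: D_def)
    then show "\<exists>w. w \<in> (\<Pi>\<^sub>E K\<in>D. E F K ` vt K) \<and> \<phi> = (\<Oplus>\<^bsub>V F\<^esub>K\<in>D. w K)"
      using \<psi> by (intro exI[of _ "\<lambda>K\<in>D. E F K (\<psi> K)"]) (auto simp: D_def)
  next
    fix w w'
    assume w: "w \<in> (\<Pi>\<^sub>E K\<in>D. E F K ` vt K) \<and> \<phi> = (\<Oplus>\<^bsub>V F\<^esub>K\<in>D. w K)"
      and w': "w' \<in> (\<Pi>\<^sub>E K\<in>D. E F K ` vt K) \<and> \<phi> = (\<Oplus>\<^bsub>V F\<^esub>K\<in>D. w' K)"
    obtain \<psi> where \<psi>: "\<And>K. (K, F) \<in> r \<Longrightarrow> \<psi> K \<in> vt K" "w = (\<lambda>K\<in>D. E F K (\<psi> K))"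
      "\<phi> = (\<Oplus>\<^bsub>V F\<^esub>K\<in>D. E F K (\<psi> K))"
      using lift[of w] w by metis
    obtain \<chi> where \<chi>: "\<And>K. (K, F) \<in> r \<Longrightarrow> \<chi> K \<in> vt K" "w' = (\<lambda>K\<in>D. E F K (\<chi> K))"
      "\<phi> = (\<Oplus>\<^bsub>V F\<^esub>K\<in>D. E F K (\<chi> K))"
      using lift[of w'] w' by metis
    have "\<psi> K = \<chi> K" if "K \<in> D" for K
    proof (rule extension_decomposition_unique[OF fin F])
      show "(\<Oplus>\<^bsub>V F\<^esub>K\<in>{K. (K, F) \<in> r}. E F K (\<psi> K)) = (\<Oplus>\<^bsub>V F\<^esub>K\<in>{K. (K, F) \<in> r}. E F K (\<chi> K))"
        using trans[OF \<psi>(3)[symmetric] \<chi>(3)] by (simp only: D_def)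
      show "(K, F) \<in> r" using that by (simp add: D_def)
    qed (fact \<psi>(1) \<chi>(1))+
    then show "w = w'" unfolding \<psi>(2) \<chi>(2) by (intro restrict_ext) simp
  qed
qed

end

theorem theorem2p13:
  fixes k :: "('a, 'm) ring_scheme"
    and P :: "'p set"
    and r :: "'p rel"
    and T :: "'p"
    and V :: "'p \<Rightarrow> ('a, 'v, 'n) module_scheme"
    and tr :: "'p \<Rightarrow> 'p \<Rightarrow> 'v \<Rightarrow> 'v"
    and E :: "'p \<Rightarrow> 'p \<Rightarrow> 'v \<Rightarrow> 'v"
  assumes "finite P"
    and "partial_order_on P r"
    and "T \<in> P" and "\<forall>F\<in>P. (F, T) \<in> r"
    and "function_space k P r V tr"
    and "consistent_extension k P r V tr E"
  shows "internal_direct_sum k (V T) P (\<lambda>F. E T F ` vanishing_trace r V tr F)"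
proof -
  interpret consistent_extension k P r V tr E by fact
  have "{K. (K, T) \<in> r} = P" using assms(4) in_P by blast
  then show ?thesis using internal_direct_sum_extensions[OF assms(1,3)] by simp
qed

end
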